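(* Let $d\ge 1$, let $n_1,\dots,n_d$ be positive integers, ${\bf n}=\prod_{i=1}^d n_i$, and let $0\neq x\in\mathbb{R}^{{\bf n}}$ be a column vector with head index $e$ and head value $a$. Assume that $x$ is decomposable with respect to $n_1\times\cdots\times n_d$, and set $x_0=\frac1a x$. Let $(e_1,\dots,e_d)$, $e_i\in[1,n_i]$, be the multi-index corresponding to $e$, let $\Xi^e_{(i;d)}$ be the associated decomposition mappings, and define $$x_i:=\Xi^e_{(i;d)}\,x_0\in\mathbb{R}^{n_i},\qquad i=1,\dots,d.$$ Then every $x_i$, $i=1,\dots,d$, is monic, and $$x=a\; x_1\otimes x_2\otimes\cdots\otimes x_d .$$
   Context: $[1,n]$ denotes $\{1,\dots,n\}$ and $\delta_n^j$ the $j$-th column of the identity matrix $I_n$. $\otimes$ is the Kronecker product (for column vectors it coincides with the semi-tensor product $\ltimes$). For a nonzero vector $x$, its head index is $e(x)=\min\{s : x_s\neq 0\}$ (the position of its first nonzero entry), and its head value is the entry $x_{e(x)}$. A nonzero vector is monic if its head value is $1$. A vector $x\in\mathbb{R}^{{\bf n}}$, ${\bf n}=\prod_{i=1}^d n_i$, is decomposable with respect to $n_1\times\cdots\times n_d$ if there exist column vectors $z_i\in\mathbb{R}^{n_i}$, $i\in[1,d]$, with $x=z_1\otimes\cdots\otimes z_d$. Multi-index corresponding to $e\in[1,{\bf n}]$: the unique $(e_1,\dots,e_d)$ with $e_i\in[1,n_i]$ and $$e=(e_1-1)n_2n_3\cdots n_d+(e_2-1)n_3\cdots n_d+\cdots+(e_{d-1}-1)n_d+e_d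 .$$ Decomposition mappings: for $i\in[1,d]$, $$\Xi^e_{(i;d)}:=[\delta_{n_1}^{e_1}]^{\mathrm T}\otimes\cdots\otimes[\delta_{n_{i-1}}^{e_{i-1}}]^{\mathrm T}\otimes I_{n_i}\otimes[\delta_{n_{i+1}}^{e_{i+1}}]^{\mathrm T}\otimes\cdots\otimes[\delta_{n_d}^{e_d}]^{\mathrm T},$$ a matrix of size $n_i\times{\bf n}$. *)

theory Defs
  imports Complex_Main "Jordan_Normal_Form.Matrix"
begin

text \<open>Mathematical indices (of vector entries, of columns of the identity, of factors) are
  1-based throughout, whereas \<^typ>\<open>'a vec\<close> and \<^typ>\<open>'a mat\<close> are accessed from 0; hence the
  shifts by one below.\<close>

definition kron_mat :: "'a::semiring_1 mat \<Rightarrow> 'a mat \<Rightarrow> 'a mat" where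
  "kron_mat A B =
    mat (dim_row A * dim_row B) (dim_col A * dim_col B)
      (\<lambda>(i, j). A $$ (i div dim_row B, j div dim_col B) * B $$ (i mod dim_row B, j mod dim_col B))"

definition kron_vec :: "'a::semiring_1 vec \<Rightarrow> 'a vec \<Rightarrow> 'a vec" where
  "kron_vec u v = vec (dim_vec u * dim_vec v) (\<lambda>i. u $ (i div dim_vec v) * v $ (i mod dim_vec v))"

lemma mat_of_cols_kron_vec:
  fixes u v :: "'a::semiring_1 vec"
  shows "mat_of_cols (dim_vec u * dim_vec v) [kron_vec u v]
    = kron_mat (mat_of_cols (dim_vec u) [u]) (mat_of_cols (dim_vec v) [v])"
proof -
  have "i mod dim_vec v < dim_vec v" if "i < dim_vec u * dim_vec v" for i
    using that by (metis gr0I mod_less_divisor mult_0_right not_less0)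
  then show ?thesis
    by (intro eq_matI)
      (auto simp: kron_mat_def kron_vec_def mat_of_cols_def less_mult_imp_div_less)
qed

text \<open>The products \<open>A 1 \<otimes> \<dots> \<otimes> A d\<close>. The empty product is the unit of the Kronecker
  product, so that for \<open>d = 1\<close> one gets \<open>A 1\<close>.\<close>

primrec kron_mats :: "(nat \<Rightarrow> 'a::semiring_1 mat) \<Rightarrow> nat \<Rightarrow> 'a mat" where
  "kron_mats A 0 = 1\<^sub>m 1"
| "kron_mats A (Suc d) = kron_mat (kron_mats A d) (A (Suc d))"

primrec kron_vecs :: "(nat \<Rightarrow> 'a::semiring_1 vec) \<Rightarrow> nat \<Rightarrow> 'a vec" where
  "kron_vecs z 0 = unit_vec 1 0"
| "kron_vecs z (Suc d) = kron_vec (kron_vecs z d) (z (Suc d))"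

definition delta :: "nat \<Rightarrow> nat \<Rightarrow> 'a::semiring_1 vec" where
  "delta n j = col (1\<^sub>m n) (j - 1)"

text \<open>Head index and head value are meaningful for nonzero vectors only.\<close>

definition head_index :: "'a::zero vec \<Rightarrow> nat" where
  "head_index x = Min {s \<in> {1..dim_vec x}. x $ (s - 1) \<noteq> 0}"

definition head_value :: "'a::zero vec \<Rightarrow> 'a" where
  "head_value x = x $ (head_index x - 1)"

definition monic_vec :: "'a::zero_neq_one vec \<Rightarrow> bool" where
  "monic_vec x \<longleftrightarrow> x \<noteq> 0\<^sub>v (dim_vec x) \<and> head_value x = 1"

definition decomposable :: "nat \<Rightarrow> (nat \<Rightarrow> nat) \<Rightarrow> 'a::semiring_1 vec \<Rightarrow> bool" where
  "decomposable d n x \<longleftrightarrow>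
    (\<exists>z. (\<forall>i\<in>{1..d}. z i \<in> carrier_vec (n i)) \<and> x = kron_vecs z d)"

definition is_multi_index :: "nat \<Rightarrow> (nat \<Rightarrow> nat) \<Rightarrow> nat \<Rightarrow> (nat \<Rightarrow> nat) \<Rightarrow> bool" where
  "is_multi_index d n e es \<longleftrightarrow>
    (\<forall>i\<in>{1..d}. es i \<in> {1..n i}) \<and>
    e = (\<Sum>i = 1..<d. (es i - 1) * (\<Prod>j = i + 1..d. n j)) + es d"

text \<open>\<open>decomp_map d n es i\<close> is the matrix \<open>\<Xi>\<^sup>e\<^bsub>(i;d)\<^esub>\<close> for the multi-index \<open>es\<close> of \<open>e\<close>.\<close>

definition decomp_map ::
    "nat \<Rightarrow> (nat \<Rightarrow> nat) \<Rightarrow> (nat \<Rightarrow> nat) \<Rightarrow> nat \<Rightarrow> 'a::semiring_1 mat" where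
  "decomp_map d n es i =
    kron_mats (\<lambda>j. if j = i then 1\<^sub>m (n i) else mat_of_row (delta (n j) (es j))) d"

end

(* If x is the Kronecker product of z_1, ..., z_d and h_i is the position of the first nonzero entry
   of z_i, then the first nonzero entry of x sits at the position with mixed-radix digits
   (h_1, ..., h_d) and equals the product of the z_i(h_i).  By uniqueness of digits, e_i is h_i
   (up to the shift by one), so by the mixed-product rule the i-th decomposition mapping sends x to
   z_i times the product of the z_j(h_j) over j different from i.  Dividing by the head value of x
   leaves z_i / z_i(h_i), which is monic, and multilinearity puts the factors back together. *)
theory Submission
  imports Defs
begin

section \<open>Kronecker products: index arithmetic, units, scalars and the mixed-product
  rule\<close>

lemma sum_div_mod:
  fixes f :: "nat \<Rightarrow> nat \<Rightarrow> 'a::comm_monoid_add"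
  shows "(\<Sum>k = 0..<m * n. f (k div n) (k mod n)) = (\<Sum>i = 0..<m. \<Sum>j = 0..<n. f i j)"
proof -
  \<comment> \<open>The range splits into \<open>m\<close> consecutive blocks of length
    \<open>n\<close>, on each of which the quotient is constant.\<close>
  have "(\<Sum>k = 0..<m * n. f (k div n) (k mod n))
      = (\<Sum>i<m. \<Sum>k = i * n..<i * n + n. f (k div n) (k mod n))"
    by (simp add: sum.nat_group atLeast0LessThan)
  also have "\<dots> = (\<Sum>i<m. \<Sum>j = 0..<n. f i j)"
  proof (rule sum.cong[OF refl])
    fix i
    have "(\<Sum>k = i * n..<i * n + n. f (k div n) (k mod n))
        = (\<Sum>j = 0..<n. f ((j + i * n) div n) ((j + i * n) mod n))"
      using sum.shift_bounds_nat_ivl[of "\<lambda>k. f (k div n) (k mod n)" 0 "i * n" n]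
      by (simp add: add.commute)
    also have "\<dots> = (\<Sum>j = 0..<n. f i j)"
      by (rule sum.cong) auto
    finally show "(\<Sum>k = i * n..<i * n + n. f (k div n) (k mod n)) = (\<Sum>j = 0..<n. f i j)" .
  qed
  finally show ?thesis
    by (simp add: atLeast0LessThan)
qed

lemma mod_less_if_less_mult: "(i::nat) < m * n \<Longrightarrow> i mod n < n"
  by (metis gr0I mod_less_divisor mult_0_right not_less0)

lemma dim_kron_vec [simp]: "dim_vec (kron_vec u v) = dim_vec u * dim_vec v"
  by (simp add: kron_vec_def)

lemma dim_kron_mat [simp]:
  "dim_row (kron_mat A B) = dim_row A * dim_row B"
  "dim_col (kron_mat A B) = dim_col A * dim_col B"
  by (simp_all add: kron_mat_def)

lemma dim_kron_vecs: "dim_vec (kron_vecs z d) = (\<Prod>i = 1..d. dim_vec (z i))"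
  by (induction d) simp_all

lemma dim_col_kron_mats: "dim_col (kron_mats A d) = (\<Prod>i = 1..d. dim_col (A i))"
  by (induction d) simp_all

lemma kron_vecs_cong:
  "(\<And>i. i \<in> {1..d} \<Longrightarrow> y i = z i) \<Longrightarrow> kron_vecs y d = kron_vecs z d"
  by (induction d) auto

lemma kron_vec_unit_left [simp]: "kron_vec (unit_vec (Suc 0) 0) v = v"
  by (rule eq_vecI) (auto simp: kron_vec_def)

lemma kron_vec_unit_right [simp]: "kron_vec u (unit_vec (Suc 0) 0) = u"
  by (rule eq_vecI) (auto simp: kron_vec_def)

lemma kron_vec_smult_smult:
  fixes u v :: "'a::comm_semiring_1 vec"
  shows "kron_vec (c \<cdot>\<^sub>v u) (b \<cdot>\<^sub>v v) = (c * b) \<cdot>\<^sub>v kron_vec u v"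
  by (rule eq_vecI)
    (auto simp: kron_vec_def less_mult_imp_div_less mod_less_if_less_mult ac_simps)

lemma kron_vecs_smult:
  fixes z :: "nat \<Rightarrow> 'a::comm_semiring_1 vec"
  shows "kron_vecs (\<lambda>i. c i \<cdot>\<^sub>v z i) d = (\<Prod>i = 1..d. c i) \<cdot>\<^sub>v kron_vecs z d"
  by (induction d) (simp_all add: kron_vec_smult_smult)

text \<open>The one-dimensional unit vector is neutral for the Kronecker product, so at most one
  factor survives.\<close>

lemma kron_vecs_single:
  "kron_vecs (\<lambda>j. if j = i then v else unit_vec 1 0) d
    = (if i \<in> {1..d} then v else unit_vec 1 0)"
  by (induction d) auto

text \<open>Quotient and remainder split the column index into two independent ones, so the sum for
  each entry factors into a sum for \<open>A\<close> and a sum for \<open>B\<close>.\<close>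

lemma kron_mat_mult_kron_vec:
  fixes A B :: "'a::comm_semiring_1 mat"
  assumes "dim_col A = dim_vec u" and "dim_col B = dim_vec v"
  shows "kron_mat A B *\<^sub>v kron_vec u v = kron_vec (A *\<^sub>v u) (B *\<^sub>v v)"
proof (rule eq_vecI)
  fix i assume "i < dim_vec (kron_vec (A *\<^sub>v u) (B *\<^sub>v v))"
  then have i: "i < dim_row A * dim_row B"
    by simp
  let ?p = "i div dim_row B" and ?q = "i mod dim_row B"
  have "(kron_mat A B *\<^sub>v kron_vec u v) $ i
      = (\<Sum>k = 0..<dim_vec u * dim_vec v. (A $$ (?p, k div dim_vec v) * u $ (k div dim_vec v))
          * (B $$ (?q, k mod dim_vec v) * v $ (k mod dim_vec v)))"
    using i assms by (auto simp: scalar_prod_def kron_mat_def kron_vec_def ac_simps intro!: sum.cong)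
  also have "\<dots> = (\<Sum>k = 0..<dim_vec u. \<Sum>l = 0..<dim_vec v.
      (A $$ (?p, k) * u $ k) * (B $$ (?q, l) * v $ l))"
    by (rule sum_div_mod)
  also have "\<dots> = (A *\<^sub>v u) $ ?p * (B *\<^sub>v v) $ ?q"
    using i assms
    by (simp add: less_mult_imp_div_less mod_less_if_less_mult scalar_prod_def sum_product)
  also have "\<dots> = kron_vec (A *\<^sub>v u) (B *\<^sub>v v) $ i"
    using i by (simp add: kron_vec_def)
  finally show "(kron_mat A B *\<^sub>v kron_vec u v) $ i = kron_vec (A *\<^sub>v u) (B *\<^sub>v v) $ i" .
qed simp

lemma kron_mats_mult_kron_vecs:
  fixes A :: "nat \<Rightarrow> 'a::comm_semiring_1 mat"
  assumes "\<And>i. i \<in> {1..d} \<Longrightarrow> dim_col (A i) = dim_vec (z i)"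
  shows "kron_mats A d *\<^sub>v kron_vecs z d = kron_vecs (\<lambda>i. A i *\<^sub>v z i) d"
  using assms
proof (induction d)
  case (Suc d)
  have "dim_col (kron_mats A d) = dim_vec (kron_vecs z d)"
    unfolding dim_col_kron_mats dim_kron_vecs using Suc.prems by (intro prod.cong) auto
  then show ?case
    using Suc by (simp add: kron_mat_mult_kron_vec)
qed (simp add: one_mult_mat_vec[of _ 1])

text \<open>The row selects one entry. Writing the result as a scalar times the unit of the
  Kronecker product lets the scalar be pulled out and the unit be dropped.\<close>

lemma mat_of_row_delta_mult:
  assumes "v \<in> carrier_vec n" and "j \<in> {1..n}"
  shows "mat_of_row (delta n j) *\<^sub>v v = v $ (j - 1) \<cdot>\<^sub>v unit_vec 1 0"
  using assms by (intro eq_vecI) (auto simp: delta_def)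

section \<open>Positions of first nonzero entries\<close>

definition leads_at :: "'a::zero vec \<Rightarrow> nat \<Rightarrow> bool" where
  "leads_at u k \<longleftrightarrow> k < dim_vec u \<and> u $ k \<noteq> 0 \<and> (\<forall>j<k. u $ j = 0)"

lemma leads_at_exists:
  assumes "u \<noteq> 0\<^sub>v (dim_vec u)"
  obtains k where "leads_at u k"
proof -
  have "\<exists>k. k < dim_vec u \<and> u $ k \<noteq> 0"
    using assms by (metis eq_vecI index_zero_vec)
  then have "leads_at u (LEAST k. k < dim_vec u \<and> u $ k \<noteq> 0)"
    unfolding leads_at_def
    by (smt (verit, best) LeastI_ex less_trans not_less_Least)
  then show ?thesis
    by (rule that)
qed

text \<open>Positions in \<open>leads_at\<close> count from 0 and head indices from 1, hence the
  \<open>Suc\<close>.\<close>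

lemma head_index_if_leads_at: "leads_at u k \<Longrightarrow> head_index u = Suc k"
  unfolding head_index_def leads_at_def
proof (rule Min_eqI)
  fix s assume "k < dim_vec u \<and> u $ k \<noteq> 0 \<and> (\<forall>j<k. u $ j = 0)"
    and "s \<in> {s \<in> {1..dim_vec u}. u $ (s - 1) \<noteq> 0}"
  then have "\<not> s - 1 < k" and "1 \<le> s"
    by auto
  then show "Suc k \<le> s"
    by simp
qed auto

lemma head_value_if_leads_at: "leads_at u k \<Longrightarrow> head_value u = u $ k"
  by (simp add: head_value_def head_index_if_leads_at)

text \<open>An earlier position has its quotient below \<open>k\<close>, where \<open>u\<close>
  vanishes, or its remainder below \<open>l\<close>, where \<open>v\<close> vanishes. The entry at
  the position itself is nonzero since there are no zero divisors.\<close>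

lemma leads_at_kron_vec:
  fixes u v :: "'a::semiring_1_no_zero_divisors vec"
  assumes u: "leads_at u k" and v: "leads_at v l"
  shows "leads_at (kron_vec u v) (k * dim_vec v + l)"
    and "kron_vec u v $ (k * dim_vec v + l) = u $ k * v $ l"
proof -
  let ?n = "dim_vec v"
  have kl: "k < dim_vec u" "l < ?n"
    using u v by (auto simp: leads_at_def)
  have "Suc k * ?n \<le> dim_vec u * ?n"
    using kl by (intro mult_right_mono) auto
  then have less: "k * ?n + l < dim_vec u * ?n"
    using kl by simp
  then show eq: "kron_vec u v $ (k * ?n + l) = u $ k * v $ l"
    using kl by (simp add: kron_vec_def div_add1_eq)
  have "kron_vec u v $ j = 0" if j: "j < k * ?n + l" for j
  proof (cases "j div ?n < k")
    case True
    then show ?thesis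
      using u j less by (simp add: kron_vec_def leads_at_def)
  next
    case False
    then have "k * ?n \<le> j div ?n * ?n"
      by (intro mult_right_mono) auto
    then have "j mod ?n < l"
      using j div_mult_mod_eq[of j ?n] by linarith
    then show ?thesis
      using v j less by (simp add: kron_vec_def leads_at_def)
  qed
  then show "leads_at (kron_vec u v) (k * ?n + l)"
    using u v less eq by (simp add: leads_at_def)
qed

section \<open>Mixed-radix numbers and multi-indices\<close>

primrec mixed_radix :: "(nat \<Rightarrow> nat) \<Rightarrow> (nat \<Rightarrow> nat) \<Rightarrow> nat \<Rightarrow> nat" where
  "mixed_radix n h 0 = 0"
| "mixed_radix n h (Suc d) = mixed_radix n h d * n (Suc d) + h (Suc d)"

text \<open>Links the Horner recursion, which runs parallel to \<open>kron_vecs\<close>, to the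
  place-value sum in \<open>is_multi_index\<close>.\<close>

lemma mixed_radix_eq_sum:
  "mixed_radix n h d = (\<Sum>i = 1..d. h i * (\<Prod>j = i + 1..d. n j))"
  by (induction d) (simp_all add: sum_distrib_right prod.cl_ivl_Suc mult.assoc)

text \<open>The last digit is below its base, so dividing by that base strips it; the remaining
  digits agree by induction.\<close>

lemma mixed_radix_inject:
  assumes "mixed_radix n h d = mixed_radix n g d"
    and "\<And>i. i \<in> {1..d} \<Longrightarrow> h i < n i" and "\<And>i. i \<in> {1..d} \<Longrightarrow> g i < n i"
    and "i \<in> {1..d}"
  shows "h i = g i"
  using assms
proof (induction d)
  case (Suc d)
  let ?n = "n (Suc d)" and ?H = "mixed_radix n h d" and ?G = "mixed_radix n g d"
  have eq: "?H * ?n + h (Suc d) = ?G * ?n + g (Suc d)"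
    using Suc.prems(1) by simp
  have less: "h (Suc d) < ?n" "g (Suc d) < ?n"
    using Suc.prems by auto
  have "(?H * ?n + h (Suc d)) div ?n = ?H" "(?G * ?n + g (Suc d)) div ?n = ?G"
    using less by simp_all
  then have HG: "?H = ?G"
    using eq by simp
  show ?case
  proof (cases "i = Suc d")
    case True
    then show ?thesis using eq HG by simp
  next
    case False
    then show ?thesis using Suc HG by simp
  qed
qed simp

lemma mixed_radix_multi_index:
  assumes "1 \<le> d" and "is_multi_index d n e es"
  shows "e = Suc (mixed_radix n (\<lambda>i. es i - 1) d)"
proof -
  obtain m where d: "d = Suc m"
    using assms(1) by (cases d) auto
  have "1 \<le> es d"
    using assms by (auto simp: is_multi_index_def)
  \<comment> \<open>The last digit enters the multi-index formula unshifted, which accounts for the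
    \<open>Suc\<close> in the claim.\<close>
  then obtain k where "es d = Suc k"
    by (cases "es d") auto
  then show ?thesis
    using assms(2) unfolding is_multi_index_def mixed_radix_eq_sum d
    by (simp add: atLeastLessThanSuc_atLeastAtMost)
qed

text \<open>Each new factor turns the leading position \<open>k\<close> into
  \<open>k * dim_vec v + l\<close>, which is the recursion step of
  \<open>mixed_radix\<close>.\<close>

lemma leads_at_kron_vecs:
  fixes z :: "nat \<Rightarrow> 'a::{comm_semiring_1, semiring_1_no_zero_divisors} vec"
  assumes "\<And>i. i \<in> {1..d} \<Longrightarrow> z i \<in> carrier_vec (n i)"
    and "\<And>i. i \<in> {1..d} \<Longrightarrow> leads_at (z i) (h i)"
  shows "leads_at (kron_vecs z d) (mixed_radix n h d) \<and>
    kron_vecs z d $ mixed_radix n h d = (\<Prod>i = 1..d. z i $ h i)"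
  using assms
proof (induction d)
  case 0
  then show ?case by (simp add: leads_at_def)
next
  case (Suc d)
  have "n (Suc d) = dim_vec (z (Suc d))" "leads_at (z (Suc d)) (h (Suc d))"
    using Suc.prems(2) carrier_vecD[OF Suc.prems(1)] by auto
  then show ?case
    using Suc leads_at_kron_vec[of "kron_vecs z d" "mixed_radix n h d" "z (Suc d)" "h (Suc d)"]
    by simp
qed

section \<open>Zero factors, the action of the decomposition mappings, and normalization\<close>

lemma kron_vec_zero_left [simp]: "kron_vec (0\<^sub>v m) v = 0\<^sub>v (m * dim_vec v)"
  by (rule eq_vecI) (auto simp: kron_vec_def less_mult_imp_div_less)

lemma kron_vec_zero_right [simp]: "kron_vec u (0\<^sub>v m) = 0\<^sub>v (dim_vec u * m)"
  by (rule eq_vecI) (auto simp: kron_vec_def mod_less_if_less_mult)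

text \<open>Used in contraposition: the factors of a nonzero product all have a leading
  entry.\<close>

lemma kron_vecs_zero_factor:
  assumes "i \<in> {1..d}" and "z i = 0\<^sub>v (dim_vec (z i))"
  shows "kron_vecs z d = 0\<^sub>v (dim_vec (kron_vecs z d))"
  using assms
proof (induction d)
  case (Suc d)
  show ?case
  proof (cases "i = Suc d")
    case True
    then show ?thesis
      using Suc.prems kron_vec_zero_right by (metis dim_kron_vec kron_vecs.simps(2))
  next
    case False
    then show ?thesis
      using Suc kron_vec_zero_left
      by (metis atLeastAtMost_iff dim_kron_vec kron_vecs.simps(2) le_Suc_eq)
  qed
qed simp

lemma decomp_map_mult_kron_vecs:
  fixes z :: "nat \<Rightarrow> 'a::comm_semiring_1 vec"
  assumes z: "\<And>j. j \<in> {1..d} \<Longrightarrow> z j \<in> carrier_vec (n j)"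
    and es: "\<And>j. j \<in> {1..d} \<Longrightarrow> es j \<in> {1..n j}"
    and i: "i \<in> {1..d}"
  shows "decomp_map d n es i *\<^sub>v kron_vecs z d
    = (\<Prod>j \<in> {1..d} - {i}. z j $ (es j - 1)) \<cdot>\<^sub>v z i"
proof -
  \<comment> \<open>Factor \<open>i\<close> is kept whole by the identity matrix and gets the scalar
    1, so that all factors share the form required by \<open>kron_vecs_smult\<close>.\<close>
  define c where "c j = (if j = i then 1 else z j $ (es j - 1))" for j
  have "decomp_map d n es i *\<^sub>v kron_vecs z d
      = kron_vecs (\<lambda>j. (if j = i then 1\<^sub>m (n i) else mat_of_row (delta (n j) (es j))) *\<^sub>v z j) d"
    unfolding decomp_map_def by (intro kron_mats_mult_kron_vecs) (use i in \<open>auto simp: delta_def carrier_vecD[OF z]\<close>)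
  also have "\<dots> = kron_vecs (\<lambda>j. c j \<cdot>\<^sub>v (if j = i then z i else unit_vec 1 0)) d"
    using z es i by (intro kron_vecs_cong) (auto simp: c_def mat_of_row_delta_mult)
  also have "\<dots> = (\<Prod>j = 1..d. c j) \<cdot>\<^sub>v z i"
    using i by (simp only: kron_vecs_smult kron_vecs_single) simp
  also have "(\<Prod>j = 1..d. c j) = (\<Prod>j \<in> {1..d} - {i}. z j $ (es j - 1))"
    using i by (simp add: prod.remove[of _ i] c_def)
  finally show ?thesis .
qed

lemma monic_vec_normalized:
  fixes u :: "'a::field vec"
  assumes "leads_at u k"
  shows "monic_vec ((1 / u $ k) \<cdot>\<^sub>v u)"
proof -
  let ?v = "(1 / u $ k) \<cdot>\<^sub>v u"
  have k: "k < dim_vec u" "u $ k \<noteq> 0"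
    using assms by (auto simp: leads_at_def)
  have "leads_at ?v k"
    using assms by (auto simp: leads_at_def)
  then have "head_value ?v = 1"
    using k by (simp add: head_value_if_leads_at)
  moreover have "?v \<noteq> 0\<^sub>v (dim_vec ?v)"
  proof
    assume "?v = 0\<^sub>v (dim_vec ?v)"
    then have "?v $ k = 0"
      using k by (metis index_smult_vec(2) index_zero_vec(1))
    then show False
      using k by simp
  qed
  ultimately show ?thesis
    by (simp add: monic_vec_def)
qed

theorem mainTheorem1:
  fixes d e :: nat and n es :: "nat \<Rightarrow> nat"
    and a :: real and x x0 :: "real vec" and xs :: "nat \<Rightarrow> real vec"
  assumes "1 \<le> d"
    and "\<And>i. i \<in> {1..d} \<Longrightarrow> 1 \<le> n i"
    and "x \<in> carrier_vec (\<Prod>i = 1..d. n i)"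
    and "x \<noteq> 0\<^sub>v (\<Prod>i = 1..d. n i)"
    and "e = head_index x"
    and "a = head_value x"
    and "decomposable d n x"
    and "x0 = (1 / a) \<cdot>\<^sub>v x"
    and "is_multi_index d n e es"
    and "\<And>i. i \<in> {1..d} \<Longrightarrow> xs i = decomp_map d n es i *\<^sub>v x0"
  shows "(\<forall>i\<in>{1..d}. xs i \<in> carrier_vec (n i) \<and> monic_vec (xs i)) \<and>
    x = a \<cdot>\<^sub>v kron_vecs xs d"
proof -
  obtain z where z: "\<And>i. i \<in> {1..d} \<Longrightarrow> z i \<in> carrier_vec (n i)" and x: "x = kron_vecs z d"
    using assms(7) unfolding decomposable_def by blast
  have "\<exists>k. leads_at (z i) k" if "i \<in> {1..d}" for i
    using kron_vecs_zero_factor[OF that, of z] leads_at_exists[of "z i"] assms(3,4) x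
    by (metis carrier_vecD)
  then obtain h where h: "\<And>i. i \<in> {1..d} \<Longrightarrow> leads_at (z i) (h i)"
    by metis
  note lead = leads_at_kron_vecs[of d z n h, OF z h, folded x]
  have a: "a = (\<Prod>i = 1..d. z i $ h i)"
    using lead assms(6) head_value_if_leads_at by metis
  have nz: "z i $ h i \<noteq> 0" if "i \<in> {1..d}" for i
    using h[OF that] by (simp add: leads_at_def)
  then have "a \<noteq> 0"
    using a by simp
  have es: "es i \<in> {1..n i}" if "i \<in> {1..d}" for i
    using assms(9) that by (simp add: is_multi_index_def)
  \<comment> \<open>Both sides are \<open>e - 1\<close>: the left by the multi-index of
    \<open>e\<close>, the right because \<open>e\<close> is the head index of
    \<open>x\<close>.\<close>
  have "mixed_radix n (\<lambda>i. es i - 1) d = mixed_radix n h d"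
    using lead mixed_radix_multi_index[OF assms(1,9)] assms(5) head_index_if_leads_at
    by (metis Suc_inject)
  moreover have "h i < n i" "es i - 1 < n i" if "i \<in> {1..d}" for i
    using h[OF that] z[OF that] es[OF that] by (auto simp: leads_at_def)
  ultimately have digits: "es i - 1 = h i" if "i \<in> {1..d}" for i
    using mixed_radix_inject[of n "\<lambda>i. es i - 1" d h i] that by blast
  \<comment> \<open>The factors \<open>z i\<close> are fixed only up to scalars; dividing each by
    its leading entry removes this freedom.\<close>
  have xs: "xs i = (1 / z i $ h i) \<cdot>\<^sub>v z i" if i: "i \<in> {1..d}" for i
  proof -
    let ?M = "decomp_map d n es i :: real mat" and ?p = "\<Prod>j \<in> {1..d} - {i}. z j $ h j"
    \<comment> \<open>The column count must match \<open>x\<close> before the scalar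
      \<open>1 / a\<close> can be moved past the matrix.\<close>
    have "dim_col ?M = (\<Prod>j = 1..d. n j)"
      unfolding decomp_map_def dim_col_kron_mats by (intro prod.cong) (auto simp: delta_def)
    then have "xs i = (1 / a) \<cdot>\<^sub>v (?M *\<^sub>v x)"
      using assms(3,8) assms(10)[OF i] mult_mat_vec[of ?M "dim_row ?M" "dim_col ?M" x "1 / a"]
      by auto
    also have "?M *\<^sub>v x = ?p \<cdot>\<^sub>v z i"
      using decomp_map_mult_kron_vecs[of d z n es i, OF z es i] digits x by simp
    also have "(1 / a) \<cdot>\<^sub>v (?p \<cdot>\<^sub>v z i) = (1 / a * ?p) \<cdot>\<^sub>v z i"
      by (simp add: smult_smult_assoc)
    \<comment> \<open>The scalar \<open>?p\<close> left by the mapping is \<open>a\<close> without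
      its factor for \<open>i\<close>, so the division by \<open>a\<close> cancels it.\<close>
    also have "a = z i $ h i * ?p"
      using i by (simp add: a prod.remove[of _ i])
    then have "1 / a * ?p = 1 / z i $ h i"
      using \<open>a \<noteq> 0\<close> by (simp add: field_simps)
    finally show ?thesis .
  qed
  \<comment> \<open>By multilinearity the normalizing scalars multiply together, and their product
    is \<open>1 / a\<close>.\<close>
  have "kron_vecs xs d = (\<Prod>i = 1..d. 1 / z i $ h i) \<cdot>\<^sub>v x"
    using kron_vecs_cong[of d xs, OF xs] by (simp add: kron_vecs_smult x)
  also have "(\<Prod>i = 1..d. 1 / z i $ h i) = 1 / a"
    by (simp add: a prod_dividef)
  finally have "x = a \<cdot>\<^sub>v kron_vecs xs d"
    using \<open>a \<noteq> 0\<close> by (simp add: smult_smult_assoc)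
  moreover have "xs i \<in> carrier_vec (n i) \<and> monic_vec (xs i)" if "i \<in> {1..d}" for i
    using xs[OF that] z[OF that] monic_vec_normalized[OF h[OF that]] by simp
  ultimately show ?thesis
    by blast
qed

end
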